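(* Let $d, m \in \mathbb{N}$, let $\boldsymbol{x} = (x_1,\dots,x_d) \in \mathcal{S}$, where $\mathcal{S} = \{\boldsymbol{x}\in[0,1]^d : \sum_{i=1}^d x_i \leq 1\}$, and let $\boldsymbol{\xi} = (\xi_1,\dots,\xi_d) \sim \mathrm{Multinomial}(m,\boldsymbol{x})$. Then, for all $p_1, p_2, \dots, p_d \in \mathbb{N}_0$, $$\mathbb{E}\Big[\prod_{i=1}^d (\xi_i - \mathbb{E}[\xi_i])^{p_i}\Big] = \sum_{\ell_1=0}^{p_1} \cdots \sum_{\ell_d=0}^{p_d}\ \sum_{k_1=0}^{\ell_1} \cdots \sum_{k_d=0}^{\ell_d} m^{(\sum_{i=1}^d k_i)}\, (-m)^{\sum_{i=1}^d (p_i - \ell_i)} \prod_{i=1}^d \binom{p_i}{\ell_i} {\ell_i \brace k_i}\, x_i^{p_i - \ell_i + k_i},$$ where $m^{(k)}$ denotes the $k$-th order falling factorial of $m$, ${\ell \brace k}$ denotes a Stirling number of the second kind, and $\binom{p}{\ell} = \frac{p!}{\ell!(p-\ell)!}$ denotes the binomial coefficient.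
   Context: $\mathbb{N} = \{1,2,\dots\}$ and $\mathbb{N}_0 = \{0,1,2,\dots\}$. For $d,m\in\mathbb{N}$ and $\boldsymbol{x}\in\mathcal{S}$, the notation $\boldsymbol{\xi}=(\xi_1,\dots,\xi_d)\sim \mathrm{Multinomial}(m,\boldsymbol{x})$ means that $\boldsymbol{\xi}$ takes values in the set of $\boldsymbol{k}\in\mathbb{N}_0^d$ with $\sum_{i=1}^d k_i \leq m$ and has probability mass function $$P_{\boldsymbol{k},m}(\boldsymbol{x}) = \frac{m!}{(m-\sum_{i=1}^d k_i)!\,\prod_{i=1}^d k_i!}\,\Big(1-\sum_{i=1}^d x_i\Big)^{m-\sum_{i=1}^d k_i}\prod_{i=1}^d x_i^{k_i}.$$ (Thus only the first $d$ of the $d+1$ category counts are recorded; the remaining category has probability $1-\sum_{i=1}^d x_i$ and count $m-\sum_{i=1}^d \xi_i$.) The falling factorial is $m^{(k)} = m(m-1)\cdots(m-k+1)$ for $k\in\mathbb{N}_0$, with $m^{(0)}=1$ (so $m^{(k)}=0$ when $k>m$). The Stirling number of the second kind ${p \brace k}$ is the number of ways to partition a set of $p$ objects into $k$ non-empty subsets, with ${0 \brace 0}=1$. The convention $0^0=1$ is used throughout. *)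

theory Defs
  imports "HOL-Probability.Probability" "HOL-Combinatorics.Stirling"
begin

text \<open>
  A vector with coordinates indexed by \<open>1, ..., d\<close> is an extensional function
  on \<open>{1..d}\<close>, i.e. a member of some \<open>\<Pi>\<^sub>E i\<in>{1..d}. A i\<close>.
\<close>

definition falling_factorial :: "'a::comm_ring_1 \<Rightarrow> nat \<Rightarrow> 'a" where
  "falling_factorial a k = (\<Prod>j<k. a - of_nat j)"

definition prob_simplex :: "nat \<Rightarrow> (nat \<Rightarrow> real) set" where
  "prob_simplex d = {x \<in> {1..d} \<rightarrow>\<^sub>E {0..1}. (\<Sum>i=1..d. x i) \<le> 1}"

definition multinomial_support :: "nat \<Rightarrow> nat \<Rightarrow> (nat \<Rightarrow> nat) set" where
  "multinomial_support d m = {k \<in> {1..d} \<rightarrow>\<^sub>E UNIV. (\<Sum>i=1..d. k i) \<le> m}"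

definition multinomial_mass ::
    "nat \<Rightarrow> nat \<Rightarrow> (nat \<Rightarrow> real) \<Rightarrow> (nat \<Rightarrow> nat) \<Rightarrow> real" where
  "multinomial_mass d m x k =
     fact m / (fact (m - (\<Sum>i=1..d. k i)) * (\<Prod>i=1..d. fact (k i)))
     * (1 - (\<Sum>i=1..d. x i)) ^ (m - (\<Sum>i=1..d. k i)) * (\<Prod>i=1..d. x i ^ k i)"

text \<open>
  Only the first \<open>d\<close> of the \<open>d + 1\<close> category counts are recorded.
  Since the target measure is the counting measure on the support, the constant
  \<open>distributed\<close> says both that \<open>\<xi>\<close> takes its values in the
  support and that its probability mass function there is \<open>multinomial_mass\<close>.
  The truncation in \<open>ennreal\<close> is harmless because the mass is
  nonnegative for \<open>x\<close> in the simplex.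
\<close>

definition multinomial_distributed ::
    "'w measure \<Rightarrow> nat \<Rightarrow> nat \<Rightarrow> (nat \<Rightarrow> real) \<Rightarrow> ('w \<Rightarrow> nat \<Rightarrow> nat) \<Rightarrow> bool" where
  "multinomial_distributed M d m x \<xi> \<longleftrightarrow>
     distributed M (count_space (multinomial_support d m)) \<xi>
       (\<lambda>k. ennreal (multinomial_mass d m x k))"

end

theory Submission
  imports Defs
begin

text \<open>
  The factorial moments of a multinomial vector are
  \<open>E (\<Prod>i. \<xi>\<^sub>i\<^bsup>(r\<^sub>i)\<^esup>) = m\<^bsup>(\<Sum>i. r\<^sub>i)\<^esup> (\<Prod>i. x\<^sub>i\<^bsup>r\<^sub>i\<^esup>)\<close>: cancelling
  \<open>k\<^sub>i\<^bsup>(r\<^sub>i)\<^esup>\<close> against \<open>k\<^sub>i!\<close> leaves the expansion of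
  \<open>(1 - (\<Sum>i. x\<^sub>i) + (\<Sum>i. x\<^sub>i))\<^bsup>m - (\<Sum>i. r\<^sub>i)\<^esup>\<close>.
  Expanding each \<open>(\<xi>\<^sub>i - m x\<^sub>i)\<^bsup>p\<^sub>i\<^esup>\<close> by the binomial theorem
  and each power \<open>\<xi>\<^sub>i\<^bsup>l\<^sub>i\<^esup>\<close> in falling factorials reduces the central moments to these.
\<close>

section \<open>Falling factorials\<close>

lemma falling_factorial_0 [simp]: "falling_factorial a 0 = 1"
  by (simp add: falling_factorial_def)

lemma falling_factorial_Suc:
  "falling_factorial a (Suc k) = falling_factorial a k * (a - of_nat k)"
  by (simp add: falling_factorial_def)

lemma falling_factorial_of_nat_eq_0:
  assumes "n < k"
  shows "falling_factorial (of_nat n :: 'a::{comm_ring_1,semiring_no_zero_divisors}) k = 0"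
  unfolding falling_factorial_def
  using assms by (intro prod_zero) auto

text \<open>The case \<open>n = 0\<close> of \<open>falling_factorial_of_nat_eq_0\<close>, in the
  form met once \<open>of_nat 0\<close> has been rewritten to \<open>0\<close>.\<close>

lemma falling_factorial_zero_left: "0 < k \<Longrightarrow> falling_factorial 0 k = 0"
  unfolding falling_factorial_def by (intro prod_zero) (auto intro: bexI[of _ 0])

lemma falling_factorial_of_nat:
  assumes "k \<le> n"
  shows "falling_factorial (of_nat n :: 'a::field_char_0) k = fact n / fact (n - k)"
  using assms
proof (induction k)
  case 0
  then show ?case by simp
next
  case (Suc k)
  have fact_eq: "(fact (n - k) :: 'a) = of_nat (n - k) * fact (n - Suc k)"
    using Suc.prems by (subst fact_reduce) auto
  have nz: "(of_nat (n - k) :: 'a) \<noteq> 0"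
    using Suc.prems by (simp only: of_nat_eq_0_iff)
  have "falling_factorial (of_nat n :: 'a) (Suc k) = fact n / fact (n - k) * of_nat (n - k)"
    using Suc by (simp add: falling_factorial_Suc)
  also have "\<dots> = fact n / fact (n - Suc k)"
    unfolding fact_eq using nz by (simp del: of_nat_diff)
  finally show ?case .
qed

text \<open>Multiplying the expansion for \<open>l\<close> by \<open>a\<close> and using
  \<open>a * f k = f (k + 1) + k * f k\<close>, where \<open>f\<close> is the falling factorial of
  \<open>a\<close>, reproduces the recurrence of the Stirling numbers.\<close>

lemma power_eq_sum_Stirling_falling_factorial:
  "a ^ l = (\<Sum>k\<le>l. of_nat (Stirling l k) * falling_factorial a k)"
proof (induction l)
  case 0
  then show ?case by simp
next
  case (Suc l)
  let ?S = "\<lambda>l k. of_nat (Stirling l k) :: 'a" and ?f = "falling_factorial a"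
  \<comment> \<open>The index can move by one without boundary terms: the factor \<open>k\<close>
    kills \<open>k = 0\<close>, and \<open>Stirling l (Suc l) = 0\<close> kills the top
    term.\<close>
  have shift: "(\<Sum>k\<le>l. of_nat k * ?S l k * ?f k)
      = (\<Sum>k\<le>l. of_nat (Suc k) * ?S l (Suc k) * ?f (Suc k))"
  proof -
    have "(\<Sum>k\<le>l. of_nat k * ?S l k * ?f k) = (\<Sum>k\<le>Suc l. of_nat k * ?S l k * ?f k)"
      by simp
    also have "\<dots> = (\<Sum>k\<le>l. of_nat (Suc k) * ?S l (Suc k) * ?f (Suc k))"
      by (subst sum.atMost_Suc_shift) simp
    finally show ?thesis .
  qed
  have "a ^ Suc l = (\<Sum>k\<le>l. ?S l k * (a * ?f k))"
    by (simp add: Suc sum_distrib_left mult_ac)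
  also have "\<dots> = (\<Sum>k\<le>l. ?S l k * ?f (Suc k) + of_nat k * ?S l k * ?f k)"
    by (intro sum.cong refl) (simp add: falling_factorial_Suc algebra_simps)
  also have "\<dots> = (\<Sum>k\<le>l. ?S (Suc l) (Suc k) * ?f (Suc k))"
    by (simp add: sum.distrib shift) (simp add: algebra_simps sum.distrib)
  also have "\<dots> = (\<Sum>k\<le>Suc l. ?S (Suc l) k * ?f k)"
    by (subst sum.atMost_Suc_shift) simp
  finally show ?case .
qed

section \<open>Factorial moments\<close>

lemma sum_power_over_fact:
  fixes a b :: "'a::field_char_0"
  shows "(\<Sum>i\<le>n. a ^ i / fact i * (b ^ (n - i) / fact (n - i))) = (a + b) ^ n / fact n"
  unfolding binomial_ring sum_divide_distrib
  by (intro sum.cong refl) (simp add: binomial_fact)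

text \<open>This sums out one coordinate: \<open>j\<close> is its count and \<open>r\<close> its
  order, while \<open>R\<close> stands for the total order of the coordinates already summed.
  Cancelling the falling factorial against \<open>fact j\<close> shifts the index by
  \<open>r\<close> and leaves a binomial expansion. The \<open>if\<close> is essential, since
  truncated subtraction would turn the terms with \<open>m - j < R\<close> into 1 instead of
  0.\<close>

lemma sum_falling_factorial_power_over_fact:
  fixes a b :: "'a::field_char_0"
  shows "(\<Sum>j\<le>m. a ^ j / fact j * falling_factorial (of_nat j) r
            * (if R \<le> m - j then b ^ (m - j - R) / fact (m - j - R) else 0))
    = (if r + R \<le> m then a ^ r * ((a + b) ^ (m - (r + R)) / fact (m - (r + R))) else 0)"
    (is "sum ?g _ = _")
proof (cases "r + R \<le> m")
  case True
  define n where "n = m - (r + R)"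
  \<comment> \<open>Here \<open>r + n = m - R\<close>: below \<open>r\<close> the falling factorial
    vanishes, above \<open>m - R\<close> the guard fails.\<close>
  have "sum ?g {..m} = sum ?g {r..r + n}"
    using True by (intro sum.mono_neutral_right)
      (auto simp: n_def falling_factorial_of_nat_eq_0 falling_factorial_zero_left not_le)
  also have "\<dots> = (\<Sum>i\<le>n. ?g (r + i))"
    by (rule sum.reindex_bij_witness[of _ "\<lambda>i. r + i" "\<lambda>j. j - r"]) auto
  also have "\<dots> = (\<Sum>i\<le>n. a ^ r * (a ^ i / fact i * (b ^ (n - i) / fact (n - i))))"
  proof (rule sum.cong[OF refl])
    fix i assume "i \<in> {..n}"
    then have "R \<le> m - (r + i)" "m - (r + i) - R = n - i"
      using True by (auto simp: n_def)
    then show "?g (r + i) = a ^ r * (a ^ i / fact i * (b ^ (n - i) / fact (n - i)))"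
      using falling_factorial_of_nat[of r "r + i", where 'a = 'a]
      by (simp add: power_add del: of_nat_add)
  qed
  also have "\<dots> = a ^ r * ((a + b) ^ n / fact n)"
    by (simp only: sum_power_over_fact flip: sum_distrib_left)
  finally show ?thesis
    using True by (simp add: n_def)
next
  case False
  \<comment> \<open>Either \<open>j < r\<close> and the falling factorial vanishes, or
    \<open>j \<ge> r\<close> and then \<open>m - j \<le> m - r < R\<close>, so the guard
    fails.\<close>
  then have "?g j = 0" if "j \<le> m" for j
    using that by (cases "j < r") (auto simp: falling_factorial_of_nat_eq_0 falling_factorial_zero_left)
  then have "sum ?g {..m} = 0"
    by (intro sum.neutral) (simp only: atMost_iff Ball_def, blast)
  then show ?thesis
    using False by (simp only: if_False)
qed

lemma finite_PiE_sum_le: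
  assumes "finite A"
  shows "finite {k \<in> A \<rightarrow>\<^sub>E (UNIV :: nat set). sum k A \<le> m}"
proof (rule finite_subset)
  show "{k \<in> A \<rightarrow>\<^sub>E UNIV. sum k A \<le> m} \<subseteq> A \<rightarrow>\<^sub>E {..m}"
  proof
    fix k assume k: "k \<in> {k \<in> A \<rightarrow>\<^sub>E UNIV. sum k A \<le> m}"
    then have "k i \<le> m" if "i \<in> A" for i
      using member_le_sum[OF that, of k] assms by auto
    with k show "k \<in> A \<rightarrow>\<^sub>E {..m}"
      by (auto simp: PiE_iff)
  qed
  show "finite (A \<rightarrow>\<^sub>E {..m})"
    using assms by (intro finite_PiE) auto
qed

lemma sum_PiE_insert_sum_le:
  fixes f :: "('a \<Rightarrow> nat) \<Rightarrow> 'b::comm_monoid_add"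
  assumes "finite A" "a \<notin> A"
  shows "(\<Sum>k | k \<in> insert a A \<rightarrow>\<^sub>E UNIV \<and> sum k (insert a A) \<le> m. f k)
    = (\<Sum>j\<le>m. \<Sum>k | k \<in> A \<rightarrow>\<^sub>E UNIV \<and> sum k A \<le> m - j. f (k(a := j)))"
proof -
  have upd: "(\<Sum>i\<in>A. if i = a then j else k i) = sum k A" for k :: "'a \<Rightarrow> nat" and j
    using assms by (intro sum.cong) auto
  have "(\<Sum>j\<le>m. \<Sum>k | k \<in> A \<rightarrow>\<^sub>E UNIV \<and> sum k A \<le> m - j. f (k(a := j)))
      = (\<Sum>(j, k)\<in>(SIGMA j:{..m}. {k \<in> A \<rightarrow>\<^sub>E UNIV. sum k A \<le> m - j}). f (k(a := j)))"
    using finite_PiE_sum_le[OF assms(1)] by (intro sum.Sigma) auto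
  also have "\<dots> = (\<Sum>k | k \<in> insert a A \<rightarrow>\<^sub>E UNIV \<and> sum k (insert a A) \<le> m. f k)"
    \<comment> \<open>Resetting the value at \<open>a\<close> to \<open>undefined\<close> makes the
      remaining vector extensional on \<open>A\<close>, so that it is determined by
      \<open>k\<close>.\<close>
    by (rule sum.reindex_bij_witness[of _ "\<lambda>k. (k a, k(a := undefined))" "\<lambda>(j, k). k(a := j)"])
      (use assms in \<open>auto simp: upd PiE_iff extensional_def fun_eq_iff\<close>)
  finally show ?thesis ..
qed

text \<open>Induction over the coordinates, with the constant factor \<open>fact m\<close> left out.
  Fixing the count \<open>j\<close> of a new coordinate leaves the same sum with budget
  \<open>m - j\<close>, hence the generalization over \<open>m\<close>. Keeping \<open>y\<close>
  independent of \<open>x\<close> lets \<open>x a\<close> simply join the base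
  \<open>y + sum x A\<close>.\<close>

lemma sum_multinomial_falling_factorial:
  fixes x :: "'b \<Rightarrow> 'a::field_char_0"
  assumes "finite A"
  shows "(\<Sum>k | k \<in> A \<rightarrow>\<^sub>E UNIV \<and> sum k A \<le> m. y ^ (m - sum k A) / fact (m - sum k A)
            * (\<Prod>i\<in>A. x i ^ k i / fact (k i) * falling_factorial (of_nat (k i)) (r i)))
    = (if sum r A \<le> m
       then (y + sum x A) ^ (m - sum r A) / fact (m - sum r A) * (\<Prod>i\<in>A. x i ^ r i) else 0)"
  using assms
proof (induction A arbitrary: m)
  case empty
  have "{k. k \<in> {} \<rightarrow>\<^sub>E (UNIV :: nat set) \<and> sum k {} \<le> m} = {\<lambda>_. undefined}"
    by auto
  then show ?case by simp
next
  case (insert a A)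
  let ?t = "\<lambda>k i. x i ^ k i / fact (k i) * falling_factorial (of_nat (k i)) (r i)"
  have upd: "sum (k(a := j)) A = sum k A" "(\<Prod>i\<in>A. ?t (k(a := j)) i) = (\<Prod>i\<in>A. ?t k i)"
    for k :: "'b \<Rightarrow> nat" and j
    using insert by (auto intro!: sum.cong prod.cong)
  have "(\<Sum>k | k \<in> insert a A \<rightarrow>\<^sub>E UNIV \<and> sum k (insert a A) \<le> m.
          y ^ (m - sum k (insert a A)) / fact (m - sum k (insert a A)) * (\<Prod>i\<in>insert a A. ?t k i))
      = (\<Sum>j\<le>m. x a ^ j / fact j * falling_factorial (of_nat j) (r a)
          * (\<Sum>k | k \<in> A \<rightarrow>\<^sub>E UNIV \<and> sum k A \<le> m - j.
              y ^ (m - j - sum k A) / fact (m - j - sum k A) * (\<Prod>i\<in>A. ?t k i)))"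
    unfolding sum_PiE_insert_sum_le[OF insert.hyps] sum_distrib_left
    by (intro sum.cong refl, simp only: sum.insert[OF insert.hyps]
      prod.insert[OF insert.hyps] upd fun_upd_same diff_diff_left) (simp only: mult_ac)
  also have "\<dots> = (\<Sum>j\<le>m. x a ^ j / fact j * falling_factorial (of_nat j) (r a)
          * (if sum r A \<le> m - j
             then (y + sum x A) ^ (m - j - sum r A) / fact (m - j - sum r A) else 0))
        * (\<Prod>i\<in>A. x i ^ r i)"
    unfolding insert.IH sum_distrib_right by (intro sum.cong refl) simp
  finally show ?case
    using insert.hyps unfolding sum_falling_factorial_power_over_fact
    by (simp add: add_ac)
qed

lemma finite_multinomial_support: "finite (multinomial_support d m)"
  unfolding multinomial_support_def by (rule finite_PiE_sum_le) simp

lemma multinomial_mass_nonneg: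
  assumes "x \<in> prob_simplex d"
  shows "0 \<le> multinomial_mass d m x k"
  using assms unfolding multinomial_mass_def prob_simplex_def
  by (auto intro!: mult_nonneg_nonneg divide_nonneg_nonneg prod_nonneg simp: PiE_iff)

lemma sum_multinomial_mass_falling_factorial:
  "(\<Sum>k\<in>multinomial_support d m.
      multinomial_mass d m x k * (\<Prod>i=1..d. falling_factorial (real (k i)) (r i)))
    = falling_factorial (real m) (\<Sum>i=1..d. r i) * (\<Prod>i=1..d. x i ^ r i)"
proof -
  let ?y = "1 - (\<Sum>i=1..d. x i)"
  have "(\<Sum>k\<in>multinomial_support d m.
      multinomial_mass d m x k * (\<Prod>i=1..d. falling_factorial (real (k i)) (r i)))
    = fact m * (\<Sum>k | k \<in> {1..d} \<rightarrow>\<^sub>E UNIV \<and> sum k {1..d} \<le> m.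
        ?y ^ (m - sum k {1..d}) / fact (m - sum k {1..d})
          * (\<Prod>i=1..d. x i ^ k i / fact (k i) * falling_factorial (real (k i)) (r i)))"
    unfolding sum_distrib_left multinomial_support_def multinomial_mass_def
    by (intro sum.cong refl) (simp add: prod.distrib prod_dividef)
  \<comment> \<open>The base \<open>?y + sum x {1..d}\<close> is 1, so only
    \<open>fact m / fact (m - sum r {1..d})\<close> remains; for total order above \<open>m\<close>
    both sides are 0.\<close>
  also have "\<dots> = falling_factorial (real m) (\<Sum>i=1..d. r i) * (\<Prod>i=1..d. x i ^ r i)"
    by (subst sum_multinomial_falling_factorial)
      (auto simp: falling_factorial_of_nat falling_factorial_of_nat_eq_0)
  finally show ?thesis .
qed

text \<open>Moves expectations to the finite support; nonnegativity of the mass lets the real-valued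
  density replace its \<open>ennreal\<close> image.\<close>

lemma multinomial_distributed_integral:
  assumes "multinomial_distributed M d m x \<xi>" "x \<in> prob_simplex d"
  shows "(\<integral>\<omega>. g (\<xi> \<omega>) \<partial>M)
    = (\<Sum>k\<in>multinomial_support d m. multinomial_mass d m x k * g k)"
  using distributed_integral[OF assms(1)[unfolded multinomial_distributed_def], of g]
    multinomial_mass_nonneg[OF assms(2)]
  by (simp add: lebesgue_integral_count_space_finite[OF finite_multinomial_support])

text \<open>The factorial moment whose order vector is the indicator of \<open>i\<close>, since a
  falling factorial of order 1 is its argument.\<close>

lemma multinomial_distributed_mean:
  assumes "multinomial_distributed M d m x \<xi>" "x \<in> prob_simplex d" "i \<in> {1..d}"
  shows "(\<integral>\<omega>. real (\<xi> \<omega> i) \<partial>M) = real m * x i"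
proof -
  let ?r = "\<lambda>j. if j = i then 1 else 0 :: nat"
  have "falling_factorial a (?r j) = (if j = i then a else 1)" for a :: real and j
    by (simp add: falling_factorial_def)
  moreover have "x j ^ ?r j = (if j = i then x j else 1)" for j
    by simp
  ultimately show ?thesis
    using sum_multinomial_mass_falling_factorial[of d m x ?r] assms(3)
    by (simp add: multinomial_distributed_integral[OF assms(1,2), of "\<lambda>k. real (k i)"]
      falling_factorial_def)
qed

section \<open>Central moments\<close>

lemma power_diff_eq_sum_falling_factorial:
  fixes a c :: "'a::comm_ring_1"
  shows "(a - c) ^ p = (\<Sum>l\<in>{0..p}. \<Sum>k\<in>{0..l}.
    of_nat (p choose l) * of_nat (Stirling l k) * (- c) ^ (p - l) * falling_factorial a k)"
proof -
  have "(a - c) ^ p = (\<Sum>l\<le>p. of_nat (p choose l) * a ^ l * (- c) ^ (p - l))"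
    using binomial_ring[of a "- c" p] by simp
  then show ?thesis
    unfolding power_eq_sum_Stirling_falling_factorial[of a]
    by (simp add: sum_distrib_left sum_distrib_right mult_ac atLeast0AtMost)
qed

text \<open>Distributivity applied twice: first a choice of \<open>l i\<close> for every
  \<open>i\<close>, then, depending on \<open>l\<close>, a choice of \<open>k i\<close>.\<close>

lemma prod_power_diff_eq_sum_falling_factorial:
  fixes a c :: "'b \<Rightarrow> 'a::comm_ring_1"
  assumes "finite A"
  shows "(\<Prod>i\<in>A. (a i - c i) ^ p i)
    = (\<Sum>l\<in>(\<Pi>\<^sub>E i\<in>A. {0..p i}). \<Sum>k\<in>(\<Pi>\<^sub>E i\<in>A. {0..l i}).
        (\<Prod>i\<in>A. of_nat (p i choose l i) * of_nat (Stirling (l i) (k i)) * (- c i) ^ (p i - l i))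
        * (\<Prod>i\<in>A. falling_factorial (a i) (k i)))"
  unfolding power_diff_eq_sum_falling_factorial
  using assms by (simp add: prod_sum_PiE flip: prod.distrib)

theorem theorem2:
  fixes M :: "'w measure" and d m :: nat and x :: "nat \<Rightarrow> real"
    and \<xi> :: "'w \<Rightarrow> nat \<Rightarrow> nat" and p :: "nat \<Rightarrow> nat"
  assumes "prob_space M"
    and "d \<ge> 1" and "m \<ge> 1"
    and "x \<in> prob_simplex d"
    and "multinomial_distributed M d m x \<xi>"
  shows "prob_space.expectation M
           (\<lambda>\<omega>. \<Prod>i=1..d. (real (\<xi> \<omega> i) - prob_space.expectation M (\<lambda>\<omega>. real (\<xi> \<omega> i))) ^ p i)
       = (\<Sum>l\<in>(\<Pi>\<^sub>E i\<in>{1..d}. {0..p i}). \<Sum>k\<in>(\<Pi>\<^sub>E i\<in>{1..d}. {0..l i}).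
            falling_factorial (real m) (\<Sum>i=1..d. k i)
            * (- real m) ^ (\<Sum>i=1..d. p i - l i)
            * (\<Prod>i=1..d. real (p i choose l i) * real (Stirling (l i) (k i))
                 * x i ^ (p i - l i + k i)))"
proof -
  let ?A = "{1..d}" and ?w = "multinomial_mass d m x" and ?\<Omega> = "multinomial_support d m"
  let ?c = "\<lambda>l k. \<Prod>i\<in>?A. real (p i choose l i) * real (Stirling (l i) (k i))
    * (- (real m * x i)) ^ (p i - l i)"
  let ?f = "\<lambda>n k. \<Prod>i\<in>?A. falling_factorial (real (n i)) (k i)"
  let ?L = "\<Pi>\<^sub>E i\<in>?A. {0..p i}" and ?K = "\<lambda>l. \<Pi>\<^sub>E i\<in>?A. {0..l i}"
  have "(\<integral>\<omega>. (\<Prod>i=1..d. (real (\<xi> \<omega> i) - (\<integral>\<omega>. real (\<xi> \<omega> i) \<partial>M)) ^ p i) \<partial>M)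
      = (\<integral>\<omega>. (\<Prod>i=1..d. (real (\<xi> \<omega> i) - real m * x i) ^ p i) \<partial>M)"
    by (intro Bochner_Integration.integral_cong prod.cong refl)
      (simp only: multinomial_distributed_mean[OF assms(5,4)])
  also have "\<dots> = (\<Sum>n\<in>?\<Omega>. ?w n * (\<Prod>i=1..d. (real (n i) - real m * x i) ^ p i))"
    by (rule multinomial_distributed_integral[OF assms(5,4)])
  also have "\<dots> = (\<Sum>n\<in>?\<Omega>. \<Sum>l\<in>?L. \<Sum>k\<in>?K l. ?c l k * (?w n * ?f n k))"
    by (simp only: prod_power_diff_eq_sum_falling_factorial[OF finite_atLeastAtMost]
      sum_distrib_left mult.left_commute)
  \<comment> \<open>The coefficient \<open>?c l k\<close> is free of \<open>n\<close>, so moving the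
    sum over \<open>n\<close> innermost isolates a factorial moment of order
    \<open>k\<close>.\<close>
  also have "\<dots> = (\<Sum>l\<in>?L. \<Sum>n\<in>?\<Omega>. \<Sum>k\<in>?K l. ?c l k * (?w n * ?f n k))"
    by (rule sum.swap)
  also have "\<dots> = (\<Sum>l\<in>?L. \<Sum>k\<in>?K l. \<Sum>n\<in>?\<Omega>. ?c l k * (?w n * ?f n k))"
    by (intro sum.cong refl sum.swap)
  also have "\<dots> = (\<Sum>l\<in>?L. \<Sum>k\<in>?K l.
      ?c l k * (falling_factorial (real m) (\<Sum>i=1..d. k i) * (\<Prod>i=1..d. x i ^ k i)))"
    by (simp only: sum_multinomial_mass_falling_factorial flip: sum_distrib_left)
  also have "\<dots> = (\<Sum>l\<in>?L. \<Sum>k\<in>?K l. falling_factorial (real m) (\<Sum>i=1..d. k i)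
      * (- real m) ^ (\<Sum>i=1..d. p i - l i)
      * (\<Prod>i=1..d. real (p i choose l i) * real (Stirling (l i) (k i)) * x i ^ (p i - l i + k i)))"
  proof (intro sum.cong refl)
    fix l k :: "nat \<Rightarrow> nat"
    \<comment> \<open>Separating \<open>- real m\<close> from \<open>x i\<close> lets its powers
      collect into one exponent over all \<open>i\<close>, while \<open>x i ^ (p i - l i)\<close>
      joins \<open>x i ^ k i\<close>.\<close>
    have "(- (real m * x i)) ^ (p i - l i) = (- real m) ^ (p i - l i) * x i ^ (p i - l i)" for i
      by (simp flip: power_mult_distrib)
    then show "?c l k * (falling_factorial (real m) (\<Sum>i=1..d. k i) * (\<Prod>i=1..d. x i ^ k i))
      = falling_factorial (real m) (\<Sum>i=1..d. k i) * (- real m) ^ (\<Sum>i=1..d. p i - l i)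
      * (\<Prod>i=1..d. real (p i choose l i) * real (Stirling (l i) (k i)) * x i ^ (p i - l i + k i))"
      by (simp add: prod.distrib power_add power_sum mult_ac)
  qed
  finally show ?thesis .
qed

end
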